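(* Let $k\ge 2$ and $n$ be positive integers with $k\mid n$, and let $\mathcal{K}^k_n$ be the complete $k$-graph on $n$ vertices. Let $a$ be the largest integer such that $\frac{n}{k}-(a-1)k>0$ and $b$ the largest integer such that $\frac{n}{k}-(b-1)(k+1)>0$. Then for every positive integer $r<\Delta(\mathcal{K}^k_n)$, \[ ms_r(\mathcal{K}^k_n)\ge (r-1)\frac{n}{k}+a\quad\text{and}\quad cms_r(\mathcal{K}^k_n)\ge (r-1)\frac{n}{k}+b. \]
   Context: A $k$-graph is a pair $(V,E)$ where $E$ is a family of $k$-element subsets of $V$; $\mathcal{K}^k_n$ has all $k$-subsets of an $n$-set as edges. The degree of a vertex is the number of edges containing it, and $\Delta$ is the maximum degree. A sub-hypergraph is $(\le r)$-regular if every vertex has degree at most $r$ in it. For an integer $N$, $[N]=\{0,\dots,N-1\}$. An ordering of a hypergraph with edge set $E$ is a bijection $\ell:E\to[|E|]$; edges are consecutive (resp. cyclically consecutive) if their labels are consecutive integers (resp. modulo $|E|$). $ms_r(\mathcal{H})$ (resp. $cms_r(\mathcal{H})$) is the maximum over orderings $\ell$ of the largest $s$ such that every $s$ consecutive (resp. cyclically consecutive) edges of $\ell$ form a $(\le r)$-regular sub-hypergraph. *)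

theory Defs
  imports Complex_Main
begin

type_synonym 'a hypergraph = "'a set \<times> 'a set set"

abbreviation verts :: "'a hypergraph \<Rightarrow> 'a set" where "verts H \<equiv> fst H"

abbreviation edges :: "'a hypergraph \<Rightarrow> 'a set set" where "edges H \<equiv> snd H"

definition complete_kgraph :: "nat \<Rightarrow> 'a set \<Rightarrow> 'a hypergraph" where
  "complete_kgraph k V = (V, {e. e \<subseteq> V \<and> card e = k})"

definition degree :: "'a hypergraph \<Rightarrow> 'a \<Rightarrow> nat" where
  "degree H v = card {e \<in> edges H. v \<in> e}"

definition max_degree :: "'a hypergraph \<Rightarrow> nat" where
  "max_degree H = Max (degree H ` verts H)"

definition le_regular :: "nat \<Rightarrow> 'a hypergraph \<Rightarrow> bool" where
  "le_regular r H \<longleftrightarrow> (\<forall>v\<in>verts H. degree H v \<le> r)"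

definition is_ordering :: "'a hypergraph \<Rightarrow> ('a set \<Rightarrow> nat) \<Rightarrow> bool" where
  "is_ordering H l \<longleftrightarrow> bij_betw l (edges H) {0..<card (edges H)}"

definition consecutive ::
  "'a hypergraph \<Rightarrow> ('a set \<Rightarrow> nat) \<Rightarrow> nat \<Rightarrow> 'a set set \<Rightarrow> bool" where
  "consecutive H l s F \<longleftrightarrow>
     F \<subseteq> edges H \<and> card F = s \<and> (\<exists>i. l ` F = {i..<i + s})"

definition cyclically_consecutive ::
  "'a hypergraph \<Rightarrow> ('a set \<Rightarrow> nat) \<Rightarrow> nat \<Rightarrow> 'a set set \<Rightarrow> bool" where
  "cyclically_consecutive H l s F \<longleftrightarrow>
     F \<subseteq> edges H \<and> card F = s \<and>
     (\<exists>i. l ` F = (\<lambda>j. (i + j) mod card (edges H)) ` {0..<s})"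

text \<open>
  In the next two definitions the bound \<open>s \<le> card (edges H)\<close> is essential: beyond it there
  are no \<open>s\<close> consecutive edges, the condition is vacuous, and no largest \<open>s\<close> would exist.
\<close>

definition ms_ord :: "nat \<Rightarrow> 'a hypergraph \<Rightarrow> ('a set \<Rightarrow> nat) \<Rightarrow> nat" where
  "ms_ord r H l =
     Max {s. s \<le> card (edges H) \<and> (\<forall>F. consecutive H l s F \<longrightarrow> le_regular r (verts H, F))}"

definition cms_ord :: "nat \<Rightarrow> 'a hypergraph \<Rightarrow> ('a set \<Rightarrow> nat) \<Rightarrow> nat" where
  "cms_ord r H l =
     Max {s. s \<le> card (edges H) \<and>
             (\<forall>F. cyclically_consecutive H l s F \<longrightarrow> le_regular r (verts H, F))}"

definition ms :: "nat \<Rightarrow> 'a hypergraph \<Rightarrow> nat" where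
  "ms r H = Max {ms_ord r H l | l. is_ordering H l}"

definition cms :: "nat \<Rightarrow> 'a hypergraph \<Rightarrow> nat" where
  "cms r H = Max {cms_ord r H l | l. is_ordering H l}"

end

theory Submission
  imports Defs "HOL-Combinatorics.Permutations"
begin

text \<open>
  Write \<open>m = n / k\<close>. By Baranyai's theorem the complete \<open>k\<close>-graph splits into
  \<open>N = (n - 1) choose (k - 1)\<close> perfect matchings with \<open>m\<close> edges each; list them one after
  another. A window of length \<open>(r - 1) * m + d\<close> with \<open>d \<le> m\<close> touches at most \<open>r + 1\<close>
  consecutive matchings, so a vertex can exceed degree \<open>r\<close> only if it is covered both by the end of
  some matching and by the beginning of the matching \<open>r\<close> places later. Each matching in turn is
  ordered greedily so that its first \<open>d - 1\<close> edges avoid the conflicting last edges of the matching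
  \<open>r\<close> places earlier, which is possible if \<open>(d - 1) * k < m\<close>. In the cyclic case the last
  \<open>d - 1\<close> edges may also have to avoid the first edges of the matching \<open>r\<close> places later,
  which is possible if \<open>(d - 1) * (k + 1) < m\<close>.

  Baranyai's theorem is proved by adding the vertices one at a time: each matching has to choose the
  trace that receives the new vertex, and weighting a trace \<open>S\<close> by \<open>k - card S\<close> verifies
  Hall's condition for a choice with the right multiplicities.
\<close>

section \<open>Baranyai's theorem\<close>

text \<open>Induction on \<open>card I\<close>. A proper nonempty subfamily whose union is no larger
  than itself splits the problem in two; if there is none, every proper nonempty subfamily has a
  spare element and one representative can be fixed arbitrarily.\<close>

lemma hall_marriage:
  fixes A :: "'i \<Rightarrow> 'b set"
  assumes "finite I" and "\<And>i. i \<in> I \<Longrightarrow> finite (A i)"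
    and "\<And>J. J \<subseteq> I \<Longrightarrow> card J \<le> card (\<Union>(A ` J))"
  shows "\<exists>R. inj_on R I \<and> (\<forall>i\<in>I. R i \<in> A i)"
  using assms
proof (induction "card I" arbitrary: I A rule: less_induct)
  case less
  note fin = less.prems(1) and finA = less.prems(2) and hall = less.prems(3)
  have finU: "finite (\<Union>(A ` J))" if "J \<subseteq> I" for J
    using that fin finA by (intro finite_UN_I) (auto intro: finite_subset)
  show ?case
  proof (cases "\<exists>J. J \<subset> I \<and> J \<noteq> {} \<and> card (\<Union>(A ` J)) \<le> card J")
    case True
    then obtain J where J: "J \<subset> I" "J \<noteq> {}" "card (\<Union>(A ` J)) \<le> card J" by blast
    have finJ: "finite J" using J fin by (meson finite_subset psubset_imp_subset)
    define B where "B i = A i - \<Union>(A ` J)" for i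
    have "\<exists>R. inj_on R J \<and> (\<forall>i\<in>J. R i \<in> A i)"
      using J fin finA hall finJ by (intro less.hyps) (auto simp: psubset_card_mono)
    then obtain R where R: "inj_on R J" "\<forall>i\<in>J. R i \<in> A i" by blast
    have "\<exists>S. inj_on S (I - J) \<and> (\<forall>i\<in>I - J. S i \<in> B i)"
    proof (rule less.hyps)
      show "card (I - J) < card I"
        using J fin by (intro psubset_card_mono) auto
      show "finite (I - J)" "\<And>i. i \<in> I - J \<Longrightarrow> finite (B i)"
        using fin finA by (auto simp: B_def)
      fix K assume K: "K \<subseteq> I - J"
      \<comment> \<open>Hall's condition for \<open>K \<union> J\<close> leaves at least
        \<open>card K\<close> elements outside the union over \<open>J\<close>, which has at most
        \<open>card J\<close> elements.\<close>
      have "card K + card J = card (K \<union> J)"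
        using K fin finJ by (subst card_Un_disjoint) (auto intro: finite_subset)
      also have "\<dots> \<le> card (\<Union>(A ` (K \<union> J)))"
        using K J by (intro hall) auto
      also have "\<Union>(A ` (K \<union> J)) = \<Union>(B ` K) \<union> \<Union>(A ` J)"
        by (auto simp: B_def)
      also have "card \<dots> \<le> card (\<Union>(B ` K)) + card (\<Union>(A ` J))"
        by (rule card_Un_le)
      finally show "card K \<le> card (\<Union>(B ` K))" using J(3) by linarith
    qed
    then obtain S where S: "inj_on S (I - J)" "\<forall>i\<in>I - J. S i \<in> B i" by blast
    have "inj_on (\<lambda>i. if i \<in> J then R i else S i) I"
    proof (rule inj_onI)
      fix i j
      assume ij: "i \<in> I" "j \<in> I"
        and eq: "(if i \<in> J then R i else S i) = (if j \<in> J then R j else S j)"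
      \<comment> \<open>Values of \<open>R\<close> lie in the union over \<open>J\<close> and values
        of \<open>S\<close> outside it, so the two parts cannot collide.\<close>
      have "(if l \<in> J then R l else S l) \<in> \<Union>(A ` J) \<longleftrightarrow> l \<in> J" if "l \<in> I" for l
        using that R(2) S(2) by (auto simp: B_def)
      then have "i \<in> J \<longleftrightarrow> j \<in> J" using eq ij by metis
      then show "i = j"
        using eq ij inj_onD[OF R(1)] inj_onD[OF S(1)] by (cases "i \<in> J") auto
    qed
    moreover have "\<forall>i\<in>I. (if i \<in> J then R i else S i) \<in> A i"
      using R S by (auto simp: B_def)
    ultimately show ?thesis by (intro exI[of _ "\<lambda>i. if i \<in> J then R i else S i"]) simp
  next
    case False
    then have strict: "card J < card (\<Union>(A ` J))" if "J \<subset> I" "J \<noteq> {}" for J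
      using that by (meson not_less)
    show ?thesis
    proof (cases "I = {}")
      case True
      then show ?thesis by simp
    next
      case False
      then obtain i where i: "i \<in> I" by blast
      have "card {i} \<le> card (\<Union>(A ` {i}))" using i by (intro hall) simp
      then have "A i \<noteq> {}" by auto
      then obtain x where x: "x \<in> A i" by blast
      have "\<exists>S. inj_on S (I - {i}) \<and> (\<forall>j\<in>I - {i}. S j \<in> A j - {x})"
      proof (rule less.hyps)
        show "card (I - {i}) < card I" using i fin by (meson card_Diff1_less)
        show "finite (I - {i})" "\<And>j. j \<in> I - {i} \<Longrightarrow> finite (A j - {x})"
          using fin finA by auto
        fix K assume K: "K \<subseteq> I - {i}"
        show "card K \<le> card (\<Union>j\<in>K. A j - {x})"
        proof (cases "K = {}")
          case False
          then have "card K < card (\<Union>(A ` K))" using K i by (intro strict) auto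
          also have "\<dots> \<le> card (\<Union>(A ` K) - {x}) + 1"
            using finU[of K] K by (metis Diff_empty Diff_insert0 Suc_eq_plus1 card_Suc_Diff1 le_add1 order_refl subset_Diff_insert)
          also have "\<Union>(A ` K) - {x} = (\<Union>j\<in>K. A j - {x})" by auto
          finally show ?thesis by simp
        qed simp
      qed
      then obtain S where S: "inj_on S (I - {i})" "\<forall>j\<in>I - {i}. S j \<in> A j - {x}" by blast
      have "inj_on (S(i := x)) I" "\<forall>j\<in>I. (S(i := x)) j \<in> A j"
        using S x by (auto simp: inj_on_def)
      then show ?thesis by blast
    qed
  qed
qed

text \<open>Split each \<open>S\<close> into \<open>c S\<close> copies and let row \<open>i\<close>
  pick a copy of one of its entries. Every row has total weight \<open>d\<close> and all occurrences
  of \<open>S\<close> together weigh \<open>d * c S\<close>, so weighing the entries of a set of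
  rows gives Hall's condition.\<close>

lemma balanced_choice:
  fixes f :: "nat \<Rightarrow> nat \<Rightarrow> 'b" and w c :: "'b \<Rightarrow> nat"
  assumes d: "d > 0" and finS: "finite \<S>"
    and mem: "\<And>i t. i < N \<Longrightarrow> t < m \<Longrightarrow> f i t \<in> \<S>"
    and weight: "\<And>i. i < N \<Longrightarrow> (\<Sum>t<m. w (f i t)) = d"
    and count: "\<And>S. S \<in> \<S> \<Longrightarrow>
      card {p \<in> {..<N} \<times> {..<m}. f (fst p) (snd p) = S} * w S = d * c S"
  shows "\<exists>u. (\<forall>i<N. u i < m) \<and> (\<forall>S\<in>\<S>. card {i \<in> {..<N}. f i (u i) = S} = c S)"
proof -
  define T where "T i = Sigma (f i ` {..<m}) (\<lambda>S. {..<c S})" for i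
  have total: "d * card J = (\<Sum>S\<in>\<S>. card {p \<in> J \<times> {..<m}. f (fst p) (snd p) = S} * w S)"
    if "J \<subseteq> {..<N}" for J
  proof -
    have finJ: "finite J" using that by (rule finite_subset) simp
    have "d * card J = (\<Sum>i\<in>J. \<Sum>t<m. w (f i t))"
      using that weight by (simp add: subset_iff)
    also have "\<dots> = (\<Sum>p\<in>J \<times> {..<m}. w (f (fst p) (snd p)))"
      by (simp add: sum.cartesian_product case_prod_beta)
    also have "\<dots> = (\<Sum>S\<in>\<S>. \<Sum>p\<in>{p \<in> J \<times> {..<m}. f (fst p) (snd p) = S}. w (f (fst p) (snd p)))"
      using finJ finS mem that by (intro sum.group[symmetric]) auto
    also have "\<dots> = (\<Sum>S\<in>\<S>. card {p \<in> J \<times> {..<m}. f (fst p) (snd p) = S} * w S)"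
      by (intro sum.cong) auto
    finally show ?thesis .
  qed
  have hall: "card J \<le> card (\<Union>(T ` J))" if J: "J \<subseteq> {..<N}" for J
  proof -
    define NJ where "NJ = (\<Union>i\<in>J. f i ` {..<m})"
    have NJ: "NJ \<subseteq> \<S>" using J mem by (auto simp: NJ_def)
    have finNJ: "finite NJ" using NJ finS by (rule finite_subset)
    have "d * card J = (\<Sum>S\<in>NJ. card {p \<in> J \<times> {..<m}. f (fst p) (snd p) = S} * w S)"
      unfolding total[OF J]
    proof (intro sum.mono_neutral_right finS NJ ballI)
      fix S assume "S \<in> \<S> - NJ"
      then have "{p \<in> J \<times> {..<m}. f (fst p) (snd p) = S} = {}" by (auto simp: NJ_def)
      then show "card {p \<in> J \<times> {..<m}. f (fst p) (snd p) = S} * w S = 0"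
        by (simp only: card.empty)
    qed
    also have "\<dots> \<le> (\<Sum>S\<in>NJ. card {p \<in> {..<N} \<times> {..<m}. f (fst p) (snd p) = S} * w S)"
      using J by (intro sum_mono mult_right_mono card_mono) (auto intro: finite_subset[of _ "{..<N} \<times> {..<m}"])
    also have "\<dots> = d * (\<Sum>S\<in>NJ. c S)"
      unfolding sum_distrib_left using NJ count by (intro sum.cong) auto
    also have "(\<Sum>S\<in>NJ. c S) = card (Sigma NJ (\<lambda>S. {..<c S}))"
      using finNJ by simp
    also have "Sigma NJ (\<lambda>S. {..<c S}) = \<Union>(T ` J)" by (auto simp: NJ_def T_def)
    finally show ?thesis using d by simp
  qed
  obtain R where R: "inj_on R {..<N}" "\<forall>i\<in>{..<N}. R i \<in> T i"
    using hall_marriage[of "{..<N}" T] hall by (auto simp: T_def)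
  \<comment> \<open>Over all rows the weights balance exactly: there are as many copies as rows, so
    the injective \<open>R\<close> uses every copy.\<close>
  have "d * N = d * (\<Sum>S\<in>\<S>. c S)"
    using total[of "{..<N}"] count by (simp add: sum_distrib_left)
  then have "card (R ` {..<N}) = card (Sigma \<S> (\<lambda>S. {..<c S}))"
    using d finS R(1) by (simp add: card_image)
  moreover have "R ` {..<N} \<subseteq> Sigma \<S> (\<lambda>S. {..<c S})"
  proof -
    have "T i \<subseteq> Sigma \<S> (\<lambda>S. {..<c S})" if "i < N" for i
      using that mem by (auto simp: T_def)
    then show ?thesis using R(2) by blast
  qed
  ultimately have R_img: "R ` {..<N} = Sigma \<S> (\<lambda>S. {..<c S})"
    using finS by (intro card_subset_eq) auto
  have "\<forall>i. \<exists>t. i < N \<longrightarrow> t < m \<and> f i t = fst (R i)"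
  proof (intro allI)
    fix i
    have "fst (R i) \<in> f i ` {..<m}" if "i < N" using R(2) that by (metis T_def SigmaE fst_conv lessThan_iff)
    then show "\<exists>t. i < N \<longrightarrow> t < m \<and> f i t = fst (R i)" by (cases "i < N") auto
  qed
  then obtain u where u: "\<And>i. i < N \<Longrightarrow> u i < m \<and> f i (u i) = fst (R i)" by metis
  have "card {i \<in> {..<N}. f i (u i) = S} = c S" if S: "S \<in> \<S>" for S
  proof -
    have "R ` {i \<in> {..<N}. f i (u i) = S} = {p \<in> R ` {..<N}. fst p = S}"
      using u by auto
    also have "\<dots> = {S} \<times> {..<c S}" unfolding R_img using S by auto
    finally have "card (R ` {i \<in> {..<N}. f i (u i) = S}) = c S" by simp
    moreover have "inj_on R {i \<in> {..<N}. f i (u i) = S}"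
      using R(1) by (rule inj_on_subset) auto
    ultimately show ?thesis by (simp add: card_image)
  qed
  then show ?thesis using u by blast
qed

text \<open>
  The traces on \<open>L\<close> of a decomposition of the complete \<open>k\<close>-graph on \<open>n\<close> vertices into
  \<open>N\<close> perfect matchings with \<open>m\<close> edges each: a set \<open>S \<subseteq> L\<close> is the trace of exactly
  \<open>(n - card L) choose (k - card S)\<close> edges.
\<close>
definition factorization_trace ::
  "nat \<Rightarrow> nat \<Rightarrow> nat \<Rightarrow> nat \<Rightarrow> 'a set \<Rightarrow> (nat \<Rightarrow> nat \<Rightarrow> 'a set) \<Rightarrow> bool" where
  "factorization_trace N m k n L f \<longleftrightarrow>
     (\<forall>i<N. \<forall>t<m. f i t \<subseteq> L \<and> card (f i t) \<le> k) \<and>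
     (\<forall>i<N. \<forall>t<m. \<forall>t'<m. t \<noteq> t' \<longrightarrow> f i t \<inter> f i t' = {}) \<and>
     (\<forall>i<N. (\<Sum>t<m. card (f i t)) = card L) \<and>
     (\<forall>S. S \<subseteq> L \<longrightarrow> card S \<le> k \<longrightarrow>
        card {p \<in> {..<N} \<times> {..<m}. f (fst p) (snd p) = S} = (n - card L) choose (k - card S))"

text \<open>The new vertex must join one set of each row. The weight \<open>k - card S\<close>
  counts the vertices that a trace still lacks, so a row weighs \<open>n - card L\<close>, and a
  fractional solution gives each occurrence of \<open>S\<close> the share \<open>k - card S\<close>
  out of \<open>n - card L\<close>; \<open>balanced_choice\<close> makes it integral.\<close>

lemma factorization_trace_insert:
  assumes tr: "factorization_trace N m k n L f" and n: "n = m * k"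
    and L: "finite L" "card L < n" "v \<notin> L"
  shows "\<exists>f'. factorization_trace N m k n (insert v L) f'"
proof -
  have sub: "\<And>i t. i < N \<Longrightarrow> t < m \<Longrightarrow> f i t \<subseteq> L"
    and le_k: "\<And>i t. i < N \<Longrightarrow> t < m \<Longrightarrow> card (f i t) \<le> k"
    and disj: "\<And>i t t'. i < N \<Longrightarrow> t < m \<Longrightarrow> t' < m \<Longrightarrow> t \<noteq> t' \<Longrightarrow> f i t \<inter> f i t' = {}"
    and total: "\<And>i. i < N \<Longrightarrow> (\<Sum>t<m. card (f i t)) = card L"
    and count: "\<And>S. S \<subseteq> L \<Longrightarrow> card S \<le> k \<Longrightarrow>
      card {p \<in> {..<N} \<times> {..<m}. f (fst p) (snd p) = S} = (n - card L) choose (k - card S)"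
    using tr by (simp_all add: factorization_trace_def)
  define d where "d = n - card L - 1"
  have d: "n - card L = Suc d" "n - card (insert v L) = d" using L by (auto simp: d_def)
  \<comment> \<open>The number of edges with trace \<open>S\<close> on \<open>L\<close> that contain
    \<open>v\<close>. The case \<open>card S = k\<close> is separate because truncated subtraction
    would turn it into \<open>d choose 0\<close>, which is 1.\<close>
  define c where "c S = (if card S < k then d choose (k - card S - 1) else 0)" for S :: "'a set"
  define \<S> where "\<S> = {S. S \<subseteq> L \<and> card S \<le> k}"
  have "\<exists>u. (\<forall>i<N. u i < m) \<and> (\<forall>S\<in>\<S>. card {i \<in> {..<N}. f i (u i) = S} = c S)"
  proof (rule balanced_choice[where d = "Suc d" and w = "\<lambda>S. k - card S"])
    show "finite \<S>" using L by (auto simp: \<S>_def)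
    show "f i t \<in> \<S>" if "i < N" "t < m" for i t using that sub le_k by (auto simp: \<S>_def)
    show "(\<Sum>t<m. k - card (f i t)) = Suc d" if "i < N" for i
    proof -
      have "(\<Sum>t<m. k - card (f i t)) = (\<Sum>t<m. k) - (\<Sum>t<m. card (f i t))"
        using that le_k by (intro sum_subtractf_nat) simp
      then show ?thesis using that total d(1) n by simp
    qed
    show "card {p \<in> {..<N} \<times> {..<m}. f (fst p) (snd p) = S} * (k - card S) = Suc d * c S"
      if "S \<in> \<S>" for S
    proof (cases "card S < k")
      case True
      then obtain j where j: "k - card S = Suc j" by (metis zero_less_diff gr0_conv_Suc)
      \<comment> \<open>Absorption:
        \<open>Suc j * (Suc d choose Suc j) = Suc d * (d choose j)\<close>.\<close>
      show ?thesis
        using that count[of S] d j Suc_times_binomial[of j d] True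
        by (simp add: \<S>_def c_def mult.commute)
    qed (simp add: c_def)
  qed simp
  then obtain u where u: "\<And>i. i < N \<Longrightarrow> u i < m"
    and cu: "\<And>S. S \<in> \<S> \<Longrightarrow> card {i \<in> {..<N}. f i (u i) = S} = c S" by blast
  have u_lt: "card (f i (u i)) < k" if "i < N" for i
  proof (rule ccontr)
    assume "\<not> card (f i (u i)) < k"
    then have "card {j \<in> {..<N}. f j (u j) = f i (u i)} = 0"
      using that cu[of "f i (u i)"] sub le_k u by (auto simp: \<S>_def c_def)
    then show False using that by auto
  qed
  define g where "g i t = (if t = u i then insert v (f i t) else f i t)" for i t
  have v_notin: "v \<notin> f i t" if "i < N" "t < m" for i t using that sub L by blast
  have fin: "finite (f i t)" if "i < N" "t < m" for i t using that sub L by (meson finite_subset)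
  have "factorization_trace N m k n (insert v L) g"
    unfolding factorization_trace_def
  proof (intro conjI allI impI)
    fix i t assume it: "i < N" "t < m"
    show "g i t \<subseteq> insert v L" using sub it by (auto simp: g_def)
    show "card (g i t) \<le> k" using u_lt le_k it fin by (auto simp: g_def card_insert_if Suc_le_eq)
    show "g i t \<inter> g i t' = {}" if "t' < m" "t \<noteq> t'" for t'
      using disj[of i t t'] it that v_notin by (auto simp: g_def)
  next
    fix i assume i: "i < N"
    have "(\<Sum>t<m. card (g i t)) = (\<Sum>t<m. card (f i t) + (if t = u i then 1 else 0))"
      using i fin v_notin by (intro sum.cong) (auto simp: g_def)
    also have "\<dots> = card (insert v L)" using i total u L by (simp add: sum.distrib)
    finally show "(\<Sum>t<m. card (g i t)) = card (insert v L)" .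
  next
    fix S assume S: "S \<subseteq> insert v L" "card S \<le> k"
    have inj_u: "inj_on (\<lambda>i. (i, u i)) A" for A by (simp add: inj_on_def)
    show "card {p \<in> {..<N} \<times> {..<m}. g (fst p) (snd p) = S} = (n - card (insert v L)) choose (k - card S)"
    proof (cases "v \<in> S")
      case True
      have finS: "finite S" using S L by (meson finite_insert finite_subset)
      have cS: "card (S - {v}) = card S - 1" "card S > 0"
        using True finS by (auto simp: card_gt_0_iff)
      \<comment> \<open>A set containing \<open>v\<close> arises only by enlarging the chosen entry
        of a row.\<close>
      have "{p \<in> {..<N} \<times> {..<m}. g (fst p) (snd p) = S}
          = (\<lambda>i. (i, u i)) ` {i \<in> {..<N}. f i (u i) = S - {v}}"
      proof -
        have "g i t = S \<longleftrightarrow> t = u i \<and> f i (u i) = S - {v}" if "i < N" "t < m" for i t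
          using that True v_notin by (auto simp: g_def)
        then have "(i, t) \<in> {p \<in> {..<N} \<times> {..<m}. g (fst p) (snd p) = S} \<longleftrightarrow>
            (i, t) \<in> (\<lambda>i. (i, u i)) ` {i \<in> {..<N}. f i (u i) = S - {v}}" for i t
          using u[of i] by (cases "i < N \<and> t < m") (auto simp: image_iff)
        then show ?thesis by (simp add: set_eq_iff)
      qed
      moreover have "S - {v} \<in> \<S>" using S cS by (auto simp: \<S>_def)
      ultimately have "card {p \<in> {..<N} \<times> {..<m}. g (fst p) (snd p) = S} = c (S - {v})"
        using cu by (simp add: card_image[OF inj_u])
      also have "\<dots> = d choose (k - card S)"
      proof -
        have "card S - 1 < k" "k - (card S - 1) - 1 = k - card S" using cS S by linarith+
        then show ?thesis using cS by (simp add: c_def)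
      qed
      finally show ?thesis by (simp only: d)
    next
      case False
      then have SL: "S \<subseteq> L" using S by blast
      \<comment> \<open>Without \<open>v\<close>, an occurrence of \<open>S\<close> survives unless
        it is chosen. Exactly \<open>c S\<close> are lost, and Pascal's rule gives the remaining
        count.\<close>
      have eq: "{p \<in> {..<N} \<times> {..<m}. f (fst p) (snd p) = S}
          = {p \<in> {..<N} \<times> {..<m}. g (fst p) (snd p) = S} \<union> (\<lambda>i. (i, u i)) ` {i \<in> {..<N}. f i (u i) = S}"
        using u False by (auto simp: g_def split: if_splits)
      have "card {p \<in> {..<N} \<times> {..<m}. f (fst p) (snd p) = S}
          = card {p \<in> {..<N} \<times> {..<m}. g (fst p) (snd p) = S} + c S"
        unfolding eq using False cu[of S] SL S
        by (subst card_Un_disjoint) (auto simp: g_def card_image[OF inj_u] \<S>_def)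
      then have "card {p \<in> {..<N} \<times> {..<m}. g (fst p) (snd p) = S} + c S = Suc d choose (k - card S)"
        using count[OF SL S(2)] d by simp
      moreover have "Suc d choose (k - card S) = (d choose (k - card S)) + c S"
      proof (cases "card S < k")
        case True
        then obtain j where "k - card S = Suc j" by (metis zero_less_diff gr0_conv_Suc)
        then show ?thesis using True by (simp add: c_def)
      qed (simp add: c_def)
      ultimately show ?thesis by (simp add: d)
    qed
  qed
  then show ?thesis by blast
qed

text \<open>With no vertices all traces are empty and the count only asks for
  \<open>N * m = (m * k) choose k\<close>. Once \<open>L = V\<close>, the count
  \<open>0 choose (k - card S)\<close> is 1 for \<open>card S = k\<close> and 0 below, so every
  \<open>k\<close>-set occurs exactly once and nothing else occurs.\<close>

theorem baranyai:
  fixes V :: "'a set"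
  assumes V: "finite V" "card V = m * k" and pos: "k > 0" "m > 0"
  defines "N \<equiv> (m * k - 1) choose (k - 1)"
  shows "\<exists>f. bij_betw (\<lambda>p. f (fst p) (snd p)) ({..<N} \<times> {..<m}) {e. e \<subseteq> V \<and> card e = k} \<and>
    (\<forall>i<N. \<forall>t<m. \<forall>t'<m. t \<noteq> t' \<longrightarrow> f i t \<inter> f i t' = {})"
proof -
  have "\<exists>f. factorization_trace N m k (m * k) L f" if "finite L" "L \<subseteq> V" for L
    using that
  proof (induction L rule: finite_induct)
    case empty
    obtain n' where n': "m * k = Suc n'" using pos by (metis nat_0_less_mult_iff gr0_conv_Suc)
    obtain k' where k': "k = Suc k'" using pos gr0_conv_Suc by blast
    have "k * (N * m) = Suc n' * (n' choose k')"
      using n' k' by (simp add: N_def mult_ac del: mult_Suc mult_Suc_right)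
    also have "\<dots> = k * ((m * k) choose k)"
      unfolding n' unfolding k' by (rule Suc_times_binomial[symmetric])
    finally have "k * (N * m) = k * ((m * k) choose k)" .
    then have "N * m = (m * k) choose k" using pos by simp
    moreover have "{p \<in> {..<N} \<times> {..<m}. True} = {..<N} \<times> {..<m}" by simp
    ultimately have "factorization_trace N m k (m * k) {} (\<lambda>_ _. {} :: 'a set)"
      by (simp add: factorization_trace_def card_cartesian_product del: Collect_mem_eq)
    then show ?case by blast
  next
    case (insert v L)
    have "card L < card V"
      using insert.hyps insert.prems V by (intro psubset_card_mono) auto
    then show ?case
      using insert V factorization_trace_insert[of N m k "m * k" L _ v] by auto
  qed
  from this[OF V(1)] obtain f where f: "factorization_trace N m k (m * k) V f" by auto
  define F where "F = (\<lambda>p. f (fst p) (snd p))"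
  define P where "P = {..<N} \<times> {..<m}"
  have FV: "F p \<subseteq> V \<and> card (F p) \<le> k" if "p \<in> P" for p
    using f that unfolding factorization_trace_def F_def P_def by (metis mem_Times_iff lessThan_iff)
  have count: "card {p \<in> P. F p = S} = 0 choose (k - card S)" if "S \<subseteq> V" "card S \<le> k" for S
    using f that V by (simp add: factorization_trace_def F_def P_def)
  have finP: "finite P" by (simp add: P_def)
  have k_F: "card (F p) = k" if "p \<in> P" for p
  proof (rule ccontr)
    assume "card (F p) \<noteq> k"
    then have "card {q \<in> P. F q = F p} = 0"
      using FV[OF that] count[of "F p"] by (simp add: binomial_eq_0)
    then have "{q \<in> P. F q = F p} = {}" using finP by simp
    then show False using that by blast
  qed
  have one: "\<exists>q. {p \<in> P. F p = S} = {q}" if "S \<subseteq> V" "card S = k" for S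
    using count[of S] that by (auto simp: card_1_singleton_iff)
  have "bij_betw F P {e. e \<subseteq> V \<and> card e = k}"
    unfolding bij_betw_def
  proof
    show "inj_on F P"
    proof (rule inj_onI)
      fix p q assume pq: "p \<in> P" "q \<in> P" "F p = F q"
      obtain z where "{r \<in> P. F r = F p} = {z}" using one[of "F p"] FV k_F pq by blast
      then show "p = q" using pq by (metis (mono_tags, lifting) mem_Collect_eq singletonD)
    qed
    show "F ` P = {e. e \<subseteq> V \<and> card e = k}"
    proof
      show "F ` P \<subseteq> {e. e \<subseteq> V \<and> card e = k}" using FV k_F by auto
      show "{e. e \<subseteq> V \<and> card e = k} \<subseteq> F ` P"
      proof
        fix e assume "e \<in> {e. e \<subseteq> V \<and> card e = k}"
        then obtain q where "{p \<in> P. F p = e} = {q}" using one[of e] by auto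
        then show "e \<in> F ` P" by blast
      qed
    qed
  qed
  moreover have "\<forall>i<N. \<forall>t<m. \<forall>t'<m. t \<noteq> t' \<longrightarrow> f i t \<inter> f i t' = {}"
    using f by (simp add: factorization_trace_def)
  ultimately show ?thesis unfolding F_def P_def by (intro exI conjI)
qed

section \<open>Greedy ordering of the matchings\<close>

text \<open>Greedy choice: when \<open>pos Q\<close> is treated, at most
  \<open>card (F Q) + Q\<close> values are forbidden or taken, fewer than \<open>m\<close>.\<close>

lemma permutation_avoiding:
  fixes F :: "nat \<Rightarrow> nat set"
  assumes "inj_on pos {..<Q}" and "\<And>q. q < Q \<Longrightarrow> pos q < m"
    and "\<And>q. q < Q \<Longrightarrow> finite (F q) \<and> card (F q) + q < m"
  shows "\<exists>\<pi>. \<pi> permutes {..<m} \<and> (\<forall>q<Q. \<pi> (pos q) \<notin> F q)"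
  using assms
proof (induction Q)
  case 0
  then show ?case using permutes_id[of "{..<m}"] by blast
next
  case (Suc Q)
  have "\<exists>\<pi>. \<pi> permutes {..<m} \<and> (\<forall>q<Q. \<pi> (pos q) \<notin> F q)"
    using Suc.prems by (intro Suc.IH) (auto simp: inj_on_def)
  then obtain \<pi> where \<pi>: "\<pi> permutes {..<m}" "\<forall>q<Q. \<pi> (pos q) \<notin> F q" by blast
  have "card (F Q \<union> (\<lambda>q. \<pi> (pos q)) ` {..<Q}) \<le> card (F Q) + Q"
    by (metis card_Un_le card_image_le card_lessThan finite_lessThan nat_add_left_cancel_le order_trans)
  then have "card (F Q \<union> (\<lambda>q. \<pi> (pos q)) ` {..<Q}) < card {..<m}"
    using Suc.prems(3)[of Q] by simp
  then have "\<not> {..<m} \<subseteq> F Q \<union> (\<lambda>q. \<pi> (pos q)) ` {..<Q}"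
    using Suc.prems(3)[of Q] by (metis card_mono finite_UnI finite_imageI finite_lessThan lessI not_less)
  then obtain y where y: "y < m" "y \<notin> F Q" "\<And>q. q < Q \<Longrightarrow> \<pi> (pos q) \<noteq> y" by blast
  obtain z where z: "z < m" "\<pi> z = y"
    using \<pi>(1) y(1) by (metis lessThan_iff permutes_image imageE)
  \<comment> \<open>The swap brings the free value \<open>y\<close> to \<open>pos Q\<close>. No
    position treated earlier has value \<open>y\<close>, so none of them equals \<open>z\<close> and
    all keep their values.\<close>
  define \<rho> where "\<rho> = \<pi> \<circ> transpose (pos Q) z"
  have "\<rho> permutes {..<m}"
    unfolding \<rho>_def using \<pi>(1) z Suc.prems(2)
    by (intro permutes_compose permutes_swap_id) auto
  moreover have "\<rho> (pos q) \<notin> F q" if "q < Suc Q" for q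
  proof (cases "q = Q")
    case True
    then show ?thesis using y z by (simp add: \<rho>_def)
  next
    case False
    then have "q < Q" using that by simp
    then have "pos q \<noteq> pos Q" "pos q \<noteq> z"
      using Suc.prems(1) y(3) z(2) by (auto simp: inj_on_def)
    then show ?thesis using \<pi>(2) \<open>q < Q\<close> by (simp add: \<rho>_def transpose_def)
  qed
  ultimately show ?case by blast
qed

text \<open>\<open>C\<close> may relate \<open>x\<close> to any earlier index, since the matchings
  that constrain each other are \<open>r\<close> places apart, possibly around the cycle.\<close>

lemma sequential_choice:
  fixes good :: "nat \<Rightarrow> 'b \<Rightarrow> bool"
  assumes step: "\<And>x g. x < N \<Longrightarrow> \<forall>y<x. good y (g y) \<Longrightarrow> \<exists>q. good x q \<and> (\<forall>y<x. C y x (g y) q)"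
  shows "\<exists>g. \<forall>x<N. good x (g x) \<and> (\<forall>y<x. C y x (g y) (g x))"
proof -
  have "\<exists>g. \<forall>x<X. good x (g x) \<and> (\<forall>y<x. C y x (g y) (g x))" if "X \<le> N" for X
    using that
  proof (induction X)
    case (Suc X)
    then obtain g where g: "\<forall>x<X. good x (g x) \<and> (\<forall>y<x. C y x (g y) (g x))" by auto
    obtain q where "good X q" "\<forall>y<X. C y X (g y) q" using step[of X g] g Suc.prems by auto
    then have "\<forall>x<Suc X. good x ((g(X := q)) x) \<and> (\<forall>y<x. C y x ((g(X := q)) y) ((g(X := q)) x))"
      using g by (auto simp: less_Suc_eq)
    then show ?case by blast
  qed simp
  then show ?thesis by blast
qed

text \<open>
  For matchings \<open>A\<close> and \<open>B\<close> listed \<open>r\<close> blocks of length \<open>m\<close> apart, this says that an edge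
  of \<open>A\<close> and an edge of \<open>B\<close> lying in a common window of length \<open>(r - 1) * m + d\<close> are disjoint.
\<close>
definition ends_disjoint :: "nat \<Rightarrow> nat \<Rightarrow> (nat \<Rightarrow> 'a set) \<Rightarrow> (nat \<Rightarrow> 'a set) \<Rightarrow> bool" where
  "ends_disjoint m d A B \<longleftrightarrow> (\<forall>i<m. \<forall>j<m. j + m < d + i \<longrightarrow> A i \<inter> B j = {})"

text \<open>Disjointness makes the choice of a point of \<open>X\<close> in each set that it meets
  injective.\<close>

lemma card_meeting_le:
  fixes B :: "nat \<Rightarrow> 'a set"
  assumes disj: "\<And>t t'. t < m \<Longrightarrow> t' < m \<Longrightarrow> t \<noteq> t' \<Longrightarrow> B t \<inter> B t' = {}"
    and X: "finite X"
  shows "card {t. t < m \<and> X \<inter> B t \<noteq> {}} \<le> card X"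
proof -
  have "\<forall>t. \<exists>x. t < m \<and> X \<inter> B t \<noteq> {} \<longrightarrow> x \<in> X \<inter> B t" by blast
  then obtain h where h: "\<And>t. t < m \<and> X \<inter> B t \<noteq> {} \<Longrightarrow> h t \<in> X \<inter> B t" by metis
  show ?thesis
  proof (rule card_inj_on_le)
    show "inj_on h {t. t < m \<and> X \<inter> B t \<noteq> {}}"
    proof (rule inj_onI)
      fix t t' assume t: "t \<in> {t. t < m \<and> X \<inter> B t \<noteq> {}}" "t' \<in> {t. t < m \<and> X \<inter> B t \<noteq> {}}" "h t = h t'"
      then have "h t \<in> B t \<inter> B t'" using h[of t] h[of t'] by auto
      then show "t = t'" using disj[of t t'] t by blast
    qed
    show "h ` {t. t < m \<and> X \<inter> B t \<noteq> {}} \<subseteq> X" using h by blast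
    show "finite X" by (rule X)
  qed
qed

lemma card_meeting_union_le:
  fixes B :: "nat \<Rightarrow> 'a set" and A :: "nat \<Rightarrow> 'a set"
  assumes "\<And>t t'. t < m \<Longrightarrow> t' < m \<Longrightarrow> t \<noteq> t' \<Longrightarrow> B t \<inter> B t' = {}"
    and "finite I" and "\<And>i. i \<in> I \<Longrightarrow> finite (A i) \<and> card (A i) \<le> k"
  shows "card {t. t < m \<and> \<Union>(A ` I) \<inter> B t \<noteq> {}} \<le> card I * k"
proof -
  have "card {t. t < m \<and> \<Union>(A ` I) \<inter> B t \<noteq> {}} \<le> card (\<Union>(A ` I))"
    using assms by (intro card_meeting_le) auto
  also have "\<dots> \<le> (\<Sum>i\<in>I. card (A i))" by (rule card_UN_le[OF assms(2)])
  also have "\<dots> \<le> (\<Sum>i\<in>I. k)" using assms(3) by (intro sum_mono) auto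
  finally show ?thesis by simp
qed

text \<open>Position \<open>q < d - 1\<close> conflicts with the last \<open>d - 1 - q\<close> edges
  of \<open>A\<close>, which meet at most \<open>(d - 1 - q) * k\<close> sets of \<open>B\<close>.
  Going from left to right, each drop of this bound by \<open>k\<close> pays for the one value used
  up, so the first position is the worst.\<close>

lemma reorder_after:
  fixes A B :: "nat \<Rightarrow> 'a set"
  assumes disj: "\<And>t t'. t < m \<Longrightarrow> t' < m \<Longrightarrow> t \<noteq> t' \<Longrightarrow> B t \<inter> B t' = {}"
    and A: "\<And>i. i < m \<Longrightarrow> finite (A i) \<and> card (A i) \<le> k"
    and d: "(d - 1) * k < m" and k: "k > 0"
  shows "\<exists>\<pi>. \<pi> permutes {..<m} \<and> ends_disjoint m d A (B \<circ> \<pi>)"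
proof -
  \<comment> \<open>\<open>i \<ge> m + q + 1 - d\<close> is the condition
    \<open>q + m < d + i\<close> of \<open>ends_disjoint\<close> solved for
    \<open>i\<close>.\<close>
  define F where "F q = {t. t < m \<and> \<Union>(A ` {m + q + 1 - d..<m}) \<inter> B t \<noteq> {}}" for q
  have dm: "d - 1 < m" using d k by (metis Suc_leI mult_le_mono2 nat_mult_1_right One_nat_def le_less_trans)
  have "\<exists>\<pi>. \<pi> permutes {..<m} \<and> (\<forall>q<d - 1. \<pi> q \<notin> F q)"
  proof (rule permutation_avoiding[where pos = "\<lambda>q. q"])
    fix q assume q: "q < d - 1"
    have "card (F q) \<le> card {m + q + 1 - d..<m} * k"
      unfolding F_def using disj A by (intro card_meeting_union_le) auto
    also have "card {m + q + 1 - d..<m} = d - 1 - q" using dm q by auto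
    finally have "card (F q) + q \<le> (d - 1 - q) * k + q * k" using k by (intro add_mono) simp_all
    also have "\<dots> = (d - 1) * k" using q by (simp flip: add_mult_distrib)
    finally show "finite (F q) \<and> card (F q) + q < m" using d by (simp add: F_def)
  qed (use dm in auto)
  then obtain \<pi> where \<pi>: "\<pi> permutes {..<m}" "\<And>q. q < d - 1 \<Longrightarrow> \<pi> q \<notin> F q" by blast
  have "A i \<inter> B (\<pi> j) = {}" if "i < m" "j < m" "j + m < d + i" for i j
  proof -
    have "j < d - 1" "i \<in> {m + j + 1 - d..<m}" using that by auto
    moreover have "\<pi> j < m" using \<pi>(1) that(2) by (metis lessThan_iff permutes_in_image)
    moreover from calculation have "\<Union>(A ` {m + j + 1 - d..<m}) \<inter> B (\<pi> j) = {}"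
      using \<pi>(2)[of j] by (simp add: F_def)
    ultimately show ?thesis by blast
  qed
  then show ?thesis using \<pi>(1) by (auto simp: ends_disjoint_def)
qed

lemma reorder_between:
  fixes A B C :: "nat \<Rightarrow> 'a set"
  assumes disj: "\<And>t t'. t < m \<Longrightarrow> t' < m \<Longrightarrow> t \<noteq> t' \<Longrightarrow> B t \<inter> B t' = {}"
    and A: "\<And>i. i < m \<Longrightarrow> finite (A i) \<and> card (A i) \<le> k"
    and C: "\<And>i. i < m \<Longrightarrow> finite (C i) \<and> card (C i) \<le> k"
    and d: "(d - 1) * (k + 1) < m" and k: "k > 0"
  shows "\<exists>\<pi>. \<pi> permutes {..<m} \<and> ends_disjoint m d A (B \<circ> \<pi>) \<and> ends_disjoint m d (B \<circ> \<pi>) C"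
proof -
  define c where "c = d - 1"
  define F where "F q = (if q < c then {t. t < m \<and> \<Union>(A ` {m + q - c..<m}) \<inter> B t \<noteq> {}}
    else {t. t < m \<and> \<Union>(C ` {..<2 * c - q}) \<inter> B t \<noteq> {}})" for q
  \<comment> \<open>For \<open>q \<ge> c\<close> the position is counted from the right end; it
    conflicts with the first \<open>2 * c - q\<close> edges of \<open>C\<close>.\<close>
  define pos where "pos q = (if q < c then q else m - 1 - (q - c))" for q
  have ck: "c * k + c < m" using d by (simp add: c_def)
  have "c \<le> c * k" using k by simp
  then have cm: "c + c < m" using ck by linarith
  have "\<exists>\<pi>. \<pi> permutes {..<m} \<and> (\<forall>q<2 * c. \<pi> (pos q) \<notin> F q)"
  proof (rule permutation_avoiding)
    show "inj_on pos {..<2 * c}" using cm by (auto simp: inj_on_def pos_def)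
    show "pos q < m" if "q < 2 * c" for q using cm that by (auto simp: pos_def)
    fix q assume q: "q < 2 * c"
    show "finite (F q) \<and> card (F q) + q < m"
    proof (cases "q < c")
      case True
      have "card (F q) \<le> card {m + q - c..<m} * k"
        unfolding F_def if_P[OF True] using disj A by (intro card_meeting_union_le) auto
      also have "card {m + q - c..<m} = c - q" using cm True by auto
      finally have "card (F q) + q \<le> (c - q) * k + q * k" using k by (intro add_mono) simp_all
      also have "\<dots> = c * k" using True by (simp flip: add_mult_distrib)
      finally show ?thesis using ck by (simp add: F_def)
    next
      case False
      have "card (F q) \<le> card {..<2 * c - q} * k"
        unfolding F_def if_not_P[OF False] using disj C cm False by (intro card_meeting_union_le) auto
      then have "card (F q) + (q - c) \<le> (2 * c - q) * k + (q - c) * k" using k by (intro add_mono) simp_all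
      also have "\<dots> = c * k" using False q by (simp flip: add_mult_distrib)
      finally show ?thesis using ck False by (simp add: F_def)
    qed
  qed
  then obtain \<pi> where \<pi>: "\<pi> permutes {..<m}" "\<And>q. q < 2 * c \<Longrightarrow> \<pi> (pos q) \<notin> F q" by blast
  have \<pi>m: "\<pi> j < m" if "j < m" for j using \<pi>(1) that by (metis lessThan_iff permutes_in_image)
  have "A i \<inter> B (\<pi> j) = {}" if "i < m" "j < m" "j + m < d + i" for i j
  proof -
    have "j < c" "i \<in> {m + j - c..<m}" using that by (auto simp: c_def)
    moreover from this have "\<Union>(A ` {m + j - c..<m}) \<inter> B (\<pi> j) = {}"
      using \<pi>(2)[of j] \<pi>m[OF that(2)] by (simp add: F_def pos_def)
    ultimately show ?thesis by blast
  qed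
  moreover have "B (\<pi> i) \<inter> C j = {}" if "i < m" "j < m" "j + m < d + i" for i j
  proof -
    define q where "q = c + (m - 1 - i)"
    have "\<not> q < c" "q < 2 * c" "pos q = i" "j < 2 * c - q"
      using that by (auto simp: c_def q_def pos_def)
    moreover from this have "\<Union>(C ` {..<2 * c - q}) \<inter> B (\<pi> i) = {}"
      using \<pi>(2)[of q] \<pi>m[OF that(1)] by (simp add: F_def)
    ultimately show ?thesis by blast
  qed
  ultimately show ?thesis using \<pi>(1) unfolding ends_disjoint_def comp_apply
    by (intro exI[of _ \<pi>] conjI) blast+
qed

section \<open>Windows of consecutive edges\<close>

text \<open>Pigeonhole: the window meets at most \<open>r + 1\<close> blocks, each with at most one
  edge through \<open>v\<close>. More than \<open>r\<close> such edges would hit both the first and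
  the last of these blocks, which \<open>far\<close> excludes.\<close>

lemma window_degree_le:
  fixes E :: "nat \<Rightarrow> 'a set"
  assumes m: "m > 0" and s: "s \<le> r * m"
    and matching: "\<And>p q. p \<in> {i..<i + s} \<Longrightarrow> q \<in> {i..<i + s} \<Longrightarrow> p \<noteq> q \<Longrightarrow>
      p div m = q div m \<Longrightarrow> E p \<inter> E q = {}"
    and far: "\<And>p q. p \<in> {i..<i + s} \<Longrightarrow> q \<in> {i..<i + s} \<Longrightarrow>
      q div m = p div m + r \<Longrightarrow> E p \<inter> E q = {}"
  shows "card {q \<in> {i..<i + s}. v \<in> E q} \<le> r"
proof (rule ccontr)
  define W where "W = {q \<in> {i..<i + s}. v \<in> E q}"
  assume "\<not> card {q \<in> {i..<i + s}. v \<in> E q} \<le> r"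
  then have big: "card W > r" by (simp add: W_def)
  have inj: "inj_on (\<lambda>q. q div m) W"
    using matching by (auto simp: inj_on_def W_def)
  have "q div m \<in> {i div m..i div m + r}" if "q \<in> W" for q
  proof -
    have "i \<le> q" "q \<le> i + r * m" using that s by (auto simp: W_def)
    then have "i div m \<le> q div m" "q div m \<le> (i + r * m) div m" by (auto intro: div_le_mono)
    then show ?thesis using m by simp
  qed
  then have sub: "(\<lambda>q. q div m) ` W \<subseteq> {i div m..i div m + r}" by auto
  have "(\<lambda>q. q div m) ` W = {i div m..i div m + r}"
    using sub big by (intro card_seteq) (auto simp: card_image[OF inj])
  then obtain p q where "p \<in> W" "q \<in> W" "p div m = i div m" "q div m = i div m + r"
    by (metis (no_types, lifting) atLeastAtMost_iff imageE le_add1 order_refl)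
  then show False using far[of p q] by (auto simp: W_def)
qed

text \<open>\<open>D\<close> covers the blocks that a window touches: \<open>{..<N}\<close> in the
  linear case, all of \<open>UNIV\<close> in the cyclic case, where indices are read modulo
  \<open>N\<close>. Since \<open>F\<close> is only an image of the window, repetitions can only
  lower degrees.\<close>

lemma block_window_degree_le:
  fixes G :: "nat \<Rightarrow> nat \<Rightarrow> 'a set"
  assumes m: "m > 0" and r: "r > 0" and d: "d \<le> m"
    and D: "\<And>q. q \<in> {i..<i + ((r - 1) * m + d)} \<Longrightarrow> q div m \<in> D"
    and matching: "\<And>x t t'. x \<in> D \<Longrightarrow> t < m \<Longrightarrow> t' < m \<Longrightarrow> t \<noteq> t' \<Longrightarrow> G x t \<inter> G x t' = {}"
    and ends: "\<And>x. x \<in> D \<Longrightarrow> x + r \<in> D \<Longrightarrow> ends_disjoint m d (G x) (G (x + r))"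
    and F: "F = (\<lambda>q. G (q div m) (q mod m)) ` {i..<i + ((r - 1) * m + d)}"
  shows "le_regular r (V, F)"
proof -
  define E where "E = (\<lambda>q. G (q div m) (q mod m))"
  define s where "s = (r - 1) * m + d"
  have rm: "r * m = (r - 1) * m + m" using r by (cases r) auto
  have "card {q \<in> {i..<i + s}. v \<in> E q} \<le> r" for v
  proof (rule window_degree_le[OF m])
    show "s \<le> r * m" using rm d by (simp add: s_def)
    fix p q assume pq: "p \<in> {i..<i + s}" "q \<in> {i..<i + s}"
    have p: "p = (p div m) * m + p mod m" and q: "q = (q div m) * m + q mod m" by simp_all
    show "E p \<inter> E q = {}" if "p \<noteq> q" "p div m = q div m"
    proof -
      have "p mod m \<noteq> q mod m" using that p q by metis
      then show ?thesis using matching D pq that m by (simp add: E_def s_def)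
    qed
    show "E p \<inter> E q = {}" if far: "q div m = p div m + r"
    proof -
      have "q < p + s" using pq by auto
      moreover have "q = p div m * m + r * m + q mod m"
        using q far by (simp add: add_mult_distrib)
      \<comment> \<open>For blocks \<open>r\<close> apart, \<open>q < p + s\<close> becomes exactly
        the condition in \<open>ends_disjoint\<close>.\<close>
      ultimately have "q mod m + m < d + p mod m" using p rm unfolding s_def by linarith
      moreover have "ends_disjoint m d (G (p div m)) (G (q div m))"
        using ends[of "p div m"] D pq far unfolding s_def by metis
      ultimately show ?thesis using m by (simp add: ends_disjoint_def E_def)
    qed
  qed
  moreover have "card {e \<in> F. v \<in> e} \<le> card {q \<in> {i..<i + s}. v \<in> E q}" for v
    by (rule surj_card_le[where f = E]) (auto simp: F E_def s_def)
  ultimately show ?thesis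
    unfolding le_regular_def degree_def by (auto intro: order_trans)
qed

section \<open>Lower bounds on \<open>ms\<close> and \<open>cms\<close> from a single
  ordering\<close>

lemma le_regular_empty: "le_regular r (V, {})"
  by (simp add: le_regular_def degree_def)

text \<open>Orderings are total functions, arbitrary off the edges, so there may be infinitely many.
  The outer maximum still ranges over a finite set, because \<open>s = 0\<close> always qualifies in
  the inner one and every \<open>ms_ord\<close> is at most \<open>card (edges H)\<close>.\<close>

lemma le_ms:
  assumes fin: "finite (edges H)" and l: "is_ordering H l" and s: "s \<le> card (edges H)"
    and reg: "\<And>F. consecutive H l s F \<Longrightarrow> le_regular r (verts H, F)"
  shows "s \<le> ms r H"
proof -
  define X where "X l = {s. s \<le> card (edges H) \<and> (\<forall>F. consecutive H l s F \<longrightarrow> le_regular r (verts H, F))}" for l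
  have finX: "finite (X l)" for l by (simp add: X_def)
  have "0 \<in> X l" for l
    using fin by (auto simp: X_def consecutive_def le_regular_empty dest: finite_subset)
  then have "Max (X l) \<in> X l" for l using finX by (intro Max_in) auto
  then have "ms_ord r H l \<le> card (edges H)" for l by (simp add: ms_ord_def X_def)
  then have "{ms_ord r H l |l. is_ordering H l} \<subseteq> {..card (edges H)}" by blast
  then have "finite {ms_ord r H l |l. is_ordering H l}" by (rule finite_subset) simp
  then have "ms_ord r H l \<le> ms r H" unfolding ms_def using l by (intro Max_ge) auto
  moreover have "s \<le> ms_ord r H l"
    using finX[of l] s reg unfolding ms_ord_def X_def by (intro Max_ge) auto
  ultimately show ?thesis by linarith
qed

lemma le_cms:
  assumes fin: "finite (edges H)" and l: "is_ordering H l" and s: "s \<le> card (edges H)"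
    and reg: "\<And>F. cyclically_consecutive H l s F \<Longrightarrow> le_regular r (verts H, F)"
  shows "s \<le> cms r H"
proof -
  define X where "X l = {s. s \<le> card (edges H) \<and>
    (\<forall>F. cyclically_consecutive H l s F \<longrightarrow> le_regular r (verts H, F))}" for l
  have finX: "finite (X l)" for l by (simp add: X_def)
  have "0 \<in> X l" for l
    using fin by (auto simp: X_def cyclically_consecutive_def le_regular_empty dest: finite_subset)
  then have "Max (X l) \<in> X l" for l using finX by (intro Max_in) auto
  then have "cms_ord r H l \<le> card (edges H)" for l by (simp add: cms_ord_def X_def)
  then have "{cms_ord r H l |l. is_ordering H l} \<subseteq> {..card (edges H)}" by blast
  then have "finite {cms_ord r H l |l. is_ordering H l}" by (rule finite_subset) simp
  then have "cms_ord r H l \<le> cms r H" unfolding cms_def using l by (intro Max_ge) auto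
  moreover have "s \<le> cms_ord r H l"
    using finX[of l] s reg unfolding cms_ord_def X_def by (intro Max_ge) auto
  ultimately show ?thesis by linarith
qed

lemma bij_betw_div_mod:
  "bij_betw (\<lambda>q. (q div m, q mod m)) {..<N * m} ({..<N} \<times> {..<m :: nat})"
proof (cases "m = 0")
  case False
  have "x * m + t < N * m" if "x < N" "t < m" for x t
  proof -
    have "x * m + t < Suc x * m" using that by simp
    also have "\<dots> \<le> N * m" using that by (intro mult_le_mono1) simp
    finally show ?thesis .
  qed
  then show ?thesis
    using False by (intro bij_betw_byWitness[where f' = "\<lambda>p. fst p * m + snd p"])
      (auto simp: less_mult_imp_div_less)
qed (simp add: bij_betw_def)

text \<open>Label \<open>q\<close> goes to edge \<open>q mod m\<close> of block
  \<open>q div m\<close>. Recovering \<open>F\<close> from its labels puts a window into the form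
  used by \<open>block_window_degree_le\<close>.\<close>

lemma block_ordering:
  fixes h :: "nat \<Rightarrow> nat \<Rightarrow> 'a set"
  assumes "bij_betw (\<lambda>p. h (fst p) (snd p)) ({..<N} \<times> {..<m}) E"
  shows "\<exists>l. is_ordering (V, E) l \<and> card E = N * m \<and>
    (\<forall>F. F \<subseteq> E \<longrightarrow> F = (\<lambda>q. h (q div m) (q mod m)) ` l ` F)"
proof -
  define e where "e = (\<lambda>q. h (q div m) (q mod m))"
  have bij: "bij_betw e {..<N * m} E"
    using bij_betw_trans[OF bij_betw_div_mod assms] by (simp add: e_def o_def)
  define l where "l = inv_into {..<N * m} e"
  have card: "card E = N * m" using bij_betw_same_card[OF bij] by simp
  have "bij_betw l E {..<N * m}" unfolding l_def by (rule bij_betw_inv_into[OF bij])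
  then have "is_ordering (V, E) l" by (simp add: is_ordering_def card atLeast0LessThan)
  moreover have "e (l x) = x" if "x \<in> E" for x
    unfolding l_def using bij that by (simp add: bij_betw_inv_into_right)
  then have "F = e ` l ` F" if "F \<subseteq> E" for F using that by (force simp: image_image)
  ultimately show ?thesis using card unfolding e_def by blast
qed

lemma block_ordering_ms:
  fixes h :: "nat \<Rightarrow> nat \<Rightarrow> 'a set"
  assumes bij: "bij_betw (\<lambda>p. h (fst p) (snd p)) ({..<N} \<times> {..<m}) E"
    and m: "m > 0" and r: "r > 0" "r \<le> N" and d: "d \<le> m"
    and matching: "\<And>x t t'. x < N \<Longrightarrow> t < m \<Longrightarrow> t' < m \<Longrightarrow> t \<noteq> t' \<Longrightarrow> h x t \<inter> h x t' = {}"
    and ends: "\<And>x. x + r < N \<Longrightarrow> ends_disjoint m d (h x) (h (x + r))"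
  shows "(r - 1) * m + d \<le> ms r (V, E)"
proof -
  obtain l where l: "is_ordering (V, E) l" "card E = N * m"
    and im: "\<And>F. F \<subseteq> E \<Longrightarrow> F = (\<lambda>q. h (q div m) (q mod m)) ` l ` F"
    using block_ordering[OF bij, of V] by blast
  define s where "s = (r - 1) * m + d"
  show ?thesis unfolding s_def[symmetric]
  proof (rule le_ms)
    show "finite (edges (V, E))" using bij_betw_finite[OF bij] by simp
    show "is_ordering (V, E) l" by (rule l)
    have "s \<le> (r - 1) * m + m" using d by (simp add: s_def)
    also have "\<dots> = r * m" using r by (cases r) auto
    also have "\<dots> \<le> N * m" using r by simp
    finally show "s \<le> card (edges (V, E))" using l by simp
    fix F assume "consecutive (V, E) l s F"
    then obtain i where F: "F \<subseteq> E" "l ` F = {i..<i + s}" by (auto simp: consecutive_def)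
    have "l ` E = {..<N * m}" using l by (simp add: is_ordering_def bij_betw_def atLeast0LessThan)
    \<comment> \<open>A linear window does not wrap around, so only blocks below \<open>N\<close>
      matter.\<close>
    then have "{i..<i + s} \<subseteq> {..<N * m}" using F by (metis image_mono)
    then have D: "q div m \<in> {..<N}" if "q \<in> {i..<i + s}" for q
      using that by (auto intro: less_mult_imp_div_less)
    have F_eq: "F = (\<lambda>q. h (q div m) (q mod m)) ` {i..<i + s}" using im[OF F(1)] F(2) by simp
    show "le_regular r (verts (V, E), F)"
      unfolding fst_conv
      by (rule block_window_degree_le[OF m r(1) d D[unfolded s_def] _ _ F_eq[unfolded s_def]])
        (use matching ends in auto)
  qed
qed

text \<open>The cycle is unrolled: a cyclic window becomes an ordinary interval, with block indices
  reduced modulo \<open>N\<close>.\<close>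

lemma block_ordering_cms:
  fixes h :: "nat \<Rightarrow> nat \<Rightarrow> 'a set"
  assumes bij: "bij_betw (\<lambda>p. h (fst p) (snd p)) ({..<N} \<times> {..<m}) E"
    and m: "m > 0" and r: "r > 0" "r \<le> N" and d: "d \<le> m"
    and matching: "\<And>x t t'. x < N \<Longrightarrow> t < m \<Longrightarrow> t' < m \<Longrightarrow> t \<noteq> t' \<Longrightarrow> h x t \<inter> h x t' = {}"
    and ends: "\<And>x. ends_disjoint m d (h (x mod N)) (h ((x + r) mod N))"
  shows "(r - 1) * m + d \<le> cms r (V, E)"
proof -
  obtain l where l: "is_ordering (V, E) l" "card E = N * m"
    and im: "\<And>F. F \<subseteq> E \<Longrightarrow> F = (\<lambda>q. h (q div m) (q mod m)) ` l ` F"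
    using block_ordering[OF bij, of V] by blast
  define s where "s = (r - 1) * m + d"
  show ?thesis unfolding s_def[symmetric]
  proof (rule le_cms)
    show "finite (edges (V, E))" using bij_betw_finite[OF bij] by simp
    show "is_ordering (V, E) l" by (rule l)
    have "s \<le> (r - 1) * m + m" using d by (simp add: s_def)
    also have "\<dots> = r * m" using r by (cases r) auto
    also have "\<dots> \<le> N * m" using r by simp
    finally show "s \<le> card (edges (V, E))" using l by simp
    fix F assume "cyclically_consecutive (V, E) l s F"
    then obtain i where F: "F \<subseteq> E" "l ` F = (\<lambda>j. (i + j) mod (N * m)) ` {0..<s}"
      using l(2) by (auto simp: cyclically_consecutive_def)
    \<comment> \<open>Writing the modulus as \<open>m * N\<close> lets \<open>mod_mult2_eq\<close>
      reduce the block index modulo \<open>N\<close> and keep the place within the block.\<close>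
    have "l ` F = (\<lambda>q. q mod (m * N)) ` (+) i ` {0..<s}"
      using F(2) by (simp only: image_image mult.commute)
    then have lF: "l ` F = (\<lambda>q. q mod (m * N)) ` {i..<i + s}"
      unfolding image_add_atLeastLessThan by (simp add: add.commute)
    have F_eq: "F = (\<lambda>q. h (q div m mod N) (q mod m)) ` {i..<i + s}"
      using im[OF F(1)] m unfolding lF by (simp add: image_image mod_mult2_eq)
    show "le_regular r (verts (V, E), F)"
      unfolding fst_conv
      by (rule block_window_degree_le[OF m r(1) d, where D = UNIV and G = "\<lambda>x. h (x mod N)" and i = i])
        (use matching ends F_eq r in \<open>auto simp: s_def\<close>)
  qed
qed

section \<open>The complete \<open>k\<close>-graph and the two bounds\<close>

lemma bij_betw_reorder_blocks:
  assumes bij: "bij_betw (\<lambda>p. f (fst p) (snd p)) ({..<N} \<times> {..<m}) E"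
    and g: "\<And>x. x < N \<Longrightarrow> g x permutes {..<m :: nat}"
  shows "bij_betw (\<lambda>p. (f (fst p) \<circ> g (fst p)) (snd p)) ({..<N :: nat} \<times> {..<m}) E"
proof -
  have "bij_betw (\<lambda>p. (fst p, g (fst p) (snd p))) ({..<N} \<times> {..<m}) ({..<N} \<times> {..<m})"
  proof (rule bij_betw_byWitness[where f' = "\<lambda>p. (fst p, inv (g (fst p)) (snd p))"])
    show "(\<lambda>p. (fst p, g (fst p) (snd p))) ` ({..<N} \<times> {..<m}) \<subseteq> {..<N} \<times> {..<m}"
      using permutes_in_image[OF g] by auto
    show "(\<lambda>p. (fst p, inv (g (fst p)) (snd p))) ` ({..<N} \<times> {..<m}) \<subseteq> {..<N} \<times> {..<m}"
      using permutes_in_image[OF permutes_inv[OF g]] by auto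
  qed (use permutes_inverses[OF g] in auto)
  from bij_betw_trans[OF this bij] show ?thesis by (simp add: o_def)
qed

text \<open>Deleting \<open>v\<close> from its edges leaves distinct \<open>(k - 1)\<close>-subsets
  of the other vertices. The bound equals the number of matchings, so the hypothesis on
  \<open>r\<close> yields \<open>r < N\<close>.\<close>

lemma max_degree_complete_kgraph_le:
  assumes "finite V" "V \<noteq> {}" "k > 0"
  shows "max_degree (complete_kgraph k V) \<le> (card V - 1) choose (k - 1)"
proof -
  have "degree (complete_kgraph k V) v \<le> (card V - 1) choose (k - 1)" if v: "v \<in> V" for v
  proof -
    have "{e \<in> edges (complete_kgraph k V). v \<in> e} \<subseteq> insert v ` {B. B \<subseteq> V - {v} \<and> card B = k - 1}"
    proof
      fix e assume "e \<in> {e \<in> edges (complete_kgraph k V). v \<in> e}"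
      then have e: "e \<subseteq> V" "card e = k" "v \<in> e" by (auto simp: complete_kgraph_def)
      then have "e - {v} \<subseteq> V - {v}" "card (e - {v}) = k - 1" "e = insert v (e - {v})"
        using assms by (auto intro: finite_subset)
      then show "e \<in> insert v ` {B. B \<subseteq> V - {v} \<and> card B = k - 1}" by blast
    qed
    then have "degree (complete_kgraph k V) v \<le> card {B. B \<subseteq> V - {v} \<and> card B = k - 1}"
      unfolding degree_def using assms by (intro surj_card_le) auto
    also have "\<dots> = card (V - {v}) choose (k - 1)" using assms by (intro n_subsets) simp
    finally show ?thesis using v assms by simp
  qed
  then show ?thesis unfolding max_degree_def
    using assms by (intro Max.boundedI) (auto simp: complete_kgraph_def)
qed

text \<open>For integers, \<open>(x - 1) * K < m\<close> means
  \<open>(x - 1) * K \<le> m - 1\<close>, so floor division finds the largest \<open>x\<close>.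
  Taking \<open>K = k\<close> gives \<open>a\<close>, and \<open>K = k + 1\<close> gives
  \<open>b\<close>.\<close>

lemma Greatest_int_mult_less:
  fixes m K :: nat
  assumes "m > 0" "K > 0"
  shows "(GREATEST x::int. real m - (real_of_int x - 1) * real K > 0) = int ((m - 1) div K + 1)"
proof -
  have iff: "real m - (real_of_int x - 1) * real K > 0 \<longleftrightarrow> (x - 1) * int K \<le> int (m - 1)" for x
  proof -
    have "real m - (real_of_int x - 1) * real K = real_of_int (int m - (x - 1) * int K)" by simp
    then have "real m - (real_of_int x - 1) * real K > 0 \<longleftrightarrow> int m - (x - 1) * int K > 0"
      by (simp only: of_int_0_less_iff)
    then show ?thesis using assms by linarith
  qed
  show ?thesis unfolding iff
  proof (rule Greatest_equality)
    have "(m - 1) div K * K \<le> m - 1" by (simp add: div_times_less_eq_dividend)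
    then have "int ((m - 1) div K * K) \<le> int (m - 1)" by (simp only: of_nat_le_iff)
    then show "(int ((m - 1) div K + 1) - 1) * int K \<le> int (m - 1)" by simp
    fix y :: int assume "(y - 1) * int K \<le> int (m - 1)"
    then have "(y - 1) * int K div int K \<le> int (m - 1) div int K"
      using assms by (intro zdiv_mono1) auto
    then show "y \<le> int ((m - 1) div K + 1)" using assms by (simp add: zdiv_int)
  qed
qed

theorem theorem35:
  fixes V :: "'a set" and n k r :: nat and a b :: int
  assumes "k \<ge> 2" and "n > 0" and "k dvd n"
    and "finite V" and "card V = n"
    and "a = (GREATEST x::int. real n / real k - (real_of_int x - 1) * real k > 0)"
    and "b = (GREATEST x::int. real n / real k - (real_of_int x - 1) * (real k + 1) > 0)"
    and "r > 0" and "r < max_degree (complete_kgraph k V)"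
  shows "real (ms r (complete_kgraph k V)) \<ge> (real r - 1) * (real n / real k) + real_of_int a
       \<and> real (cms r (complete_kgraph k V)) \<ge> (real r - 1) * (real n / real k) + real_of_int b"
proof -
  have k: "k > 0" using assms(1) by simp
  obtain m where nm: "n = m * k" using assms(3) by (metis dvd_def mult.commute)
  have m: "m > 0" using nm assms(2) by simp
  have nk: "real n / real k = real m" using nm k by simp
  define N where "N = (m * k - 1) choose (k - 1)"
  define E where "E = {e. e \<subseteq> V \<and> card e = k}"
  have H: "complete_kgraph k V = (V, E)" by (simp add: complete_kgraph_def E_def)
  have rN: "r < N"
  proof -
    have "V \<noteq> {}" using assms(2,5) by auto
    then have "max_degree (complete_kgraph k V) \<le> N"
      using max_degree_complete_kgraph_le[of V k] assms(4,5) nm k by (simp add: N_def)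
    then show ?thesis using assms(9) by linarith
  qed
  obtain f where bij: "bij_betw (\<lambda>p. f (fst p) (snd p)) ({..<N} \<times> {..<m}) E"
    and disj: "\<And>x t t'. x < N \<Longrightarrow> t < m \<Longrightarrow> t' < m \<Longrightarrow> t \<noteq> t' \<Longrightarrow> f x t \<inter> f x t' = {}"
    using baranyai[of V m k] assms(4,5) nm k m unfolding N_def E_def by blast
  have size: "finite (f x t) \<and> card (f x t) \<le> k" if "x < N" "t < m" for x t
  proof -
    have "f x t \<in> E" using bij_betw_apply[OF bij, of "(x, t)"] that by simp
    then show ?thesis using assms(4) by (auto simp: E_def intro: finite_subset)
  qed
  have perm_less: "p t < m" if "p permutes {..<m}" "t < m" for p :: "nat \<Rightarrow> nat" and t
    using permutes_in_image[OF that(1), of t] that(2) by simp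
  have size_perm: "finite ((f x \<circ> p) t) \<and> card ((f x \<circ> p) t) \<le> k"
    if "x < N" "t < m" "p permutes {..<m}" for x t p
    using size[of x "p t"] that by (simp add: perm_less)
  have disj_perm: "(f x \<circ> p) t \<inter> (f x \<circ> p) t' = {}"
    if "x < N" "p permutes {..<m}" "t < m" "t' < m" "t \<noteq> t'" for x t t' p
  proof -
    have "p t \<noteq> p t'" using that by (metis permutes_inverses(2))
    then show ?thesis using disj[of x "p t" "p t'"] that by (simp add: perm_less)
  qed
  have "(r - 1) * m + ((m - 1) div k + 1) \<le> ms r (V, E)"
  proof -
    define d where "d = (m - 1) div k + 1"
    have dm: "d \<le> m" using m div_le_dividend[of "m - 1" k] unfolding d_def by linarith
    have dk: "(d - 1) * k < m"
      using m div_times_less_eq_dividend[of "m - 1" k] unfolding d_def add_diff_cancel_right' by linarith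
    \<comment> \<open>Each matching is constrained only by the one \<open>r\<close> places earlier,
      if there is one.\<close>
    have "\<exists>g. \<forall>x<N. g x permutes {..<m} \<and>
        (\<forall>y<x. y + r = x \<longrightarrow> ends_disjoint m d (f y \<circ> g y) (f x \<circ> g x))"
    proof (rule sequential_choice)
      fix x g assume x: "x < N" and g: "\<forall>y<x. g y permutes {..<m}"
      show "\<exists>q. q permutes {..<m} \<and>
          (\<forall>y<x. y + r = x \<longrightarrow> ends_disjoint m d (f y \<circ> g y) (f x \<circ> q))"
      proof (cases "r \<le> x")
        case True
        then have "x - r < x" using assms(8) by simp
        then have "\<exists>q. q permutes {..<m} \<and> ends_disjoint m d (f (x - r) \<circ> g (x - r)) (f x \<circ> q)"
          using x g disj size_perm dk k by (intro reorder_after) auto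
        then show ?thesis by force
      next
        case False
        then have "y + r \<noteq> x" for y by auto
        then show ?thesis using permutes_id[of "{..<m}"] by blast
      qed
    qed
    then obtain g where g: "\<And>x. x < N \<Longrightarrow> g x permutes {..<m}"
      and ends: "\<And>x. x + r < N \<Longrightarrow> ends_disjoint m d (f x \<circ> g x) (f (x + r) \<circ> g (x + r))"
      using assms(8) by (metis less_add_same_cancel1)
    show ?thesis unfolding d_def[symmetric]
      using bij_betw_reorder_blocks[OF bij g] m assms(8) rN dm disj_perm g ends
      by (intro block_ordering_ms[where h = "\<lambda>x. f x \<circ> g x" and N = N]) auto
  qed
  moreover have "(r - 1) * m + ((m - 1) div (k + 1) + 1) \<le> cms r (V, E)"
  proof -
    define d where "d = (m - 1) div (k + 1) + 1"
    have dm: "d \<le> m" using m div_le_dividend[of "m - 1" "k + 1"] unfolding d_def by linarith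
    have dk: "(d - 1) * (k + 1) < m"
      using m div_times_less_eq_dividend[of "m - 1" "k + 1"]
      unfolding d_def add_diff_cancel_right' by linarith
    \<comment> \<open>On the cycle, a pair at distance \<open>r\<close> is settled when its larger
      index is treated; a wrapped pair constrains the end of the later matching.\<close>
    have "\<exists>g. \<forall>x<N. g x permutes {..<m} \<and> (\<forall>y<x.
        (y + r = x \<longrightarrow> ends_disjoint m d (f y \<circ> g y) (f x \<circ> g x)) \<and>
        (x + r = y + N \<longrightarrow> ends_disjoint m d (f x \<circ> g x) (f y \<circ> g y)))"
    proof (rule sequential_choice)
      fix x g assume x: "x < N" and g: "\<forall>y<x. g y permutes {..<m}"
      \<comment> \<open>A sequence of empty sets stands in for a missing earlier neighbour and
        imposes no constraint.\<close>
      define A where "A = (if r \<le> x then f (x - r) \<circ> g (x - r) else (\<lambda>_. {}))"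
      define C where "C = (if N \<le> x + r then f (x + r - N) \<circ> g (x + r - N) else (\<lambda>_. {}))"
      have A: "finite (A i) \<and> card (A i) \<le> k" if "i < m" for i
        using size_perm[of "x - r" i "g (x - r)"] that x g assms(8) by (auto simp: A_def)
      have C: "finite (C i) \<and> card (C i) \<le> k" if "i < m" for i
      proof (cases "N \<le> x + r")
        case True
        \<comment> \<open>The strict bound \<open>r < N\<close> ensures that the wrapped neighbour
          has already been ordered.\<close>
        then have "x + r - N < x" using rN x by linarith
        then show ?thesis
          using size_perm[of "x + r - N" i "g (x + r - N)"] that x g by (simp add: C_def)
      qed (simp add: C_def)
      have "\<exists>q. q permutes {..<m} \<and> ends_disjoint m d A (f x \<circ> q) \<and> ends_disjoint m d (f x \<circ> q) C"
        using x disj A C dk k by (intro reorder_between) auto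
      then obtain q where q: "q permutes {..<m}" "ends_disjoint m d A (f x \<circ> q)"
        "ends_disjoint m d (f x \<circ> q) C" by blast
      have "A = f y \<circ> g y" if "y + r = x" for y using that by (auto simp: A_def)
      moreover have "C = f y \<circ> g y" if "x + r = y + N" for y using that by (simp add: C_def)
      ultimately show "\<exists>q. q permutes {..<m} \<and> (\<forall>y<x.
          (y + r = x \<longrightarrow> ends_disjoint m d (f y \<circ> g y) (f x \<circ> q)) \<and>
          (x + r = y + N \<longrightarrow> ends_disjoint m d (f x \<circ> q) (f y \<circ> g y)))"
        using q by metis
    qed
    then obtain g where g: "\<And>x. x < N \<Longrightarrow> g x permutes {..<m}"
      and up: "\<And>x y. x < N \<Longrightarrow> y < x \<Longrightarrow> y + r = x \<Longrightarrow> ends_disjoint m d (f y \<circ> g y) (f x \<circ> g x)"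
      and down: "\<And>x y. x < N \<Longrightarrow> y < x \<Longrightarrow> x + r = y + N \<Longrightarrow> ends_disjoint m d (f x \<circ> g x) (f y \<circ> g y)"
      by blast
    have ends: "ends_disjoint m d (f (x mod N) \<circ> g (x mod N)) (f ((x + r) mod N) \<circ> g ((x + r) mod N))" for x
    proof -
      define y where "y = x mod N"
      have y: "y < N" using rN by (simp add: y_def)
      have yr: "(x + r) mod N = (y + r) mod N" by (simp add: y_def mod_add_left_eq)
      show ?thesis
      \<comment> \<open>Without wrapping the larger index is \<open>y + r\<close>, which gives
        \<open>up\<close>; with wrapping it is \<open>y\<close>, which gives
        \<open>down\<close>.\<close>
      proof (cases "y + r < N")
        case True
        then show ?thesis using up[of "y + r" y] yr assms(8) by (simp flip: y_def)
      next
        case False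
        then have "(y + r) mod N = y + r - N" using y rN by (simp add: mod_if)
        then show ?thesis using down[of y "y + r - N"] yr y False rN by (simp flip: y_def)
      qed
    qed
    show ?thesis unfolding d_def[symmetric]
      using bij_betw_reorder_blocks[OF bij g] m assms(8) rN dm disj_perm g ends
      by (intro block_ordering_cms[where h = "\<lambda>x. f x \<circ> g x" and N = N]) auto
  qed
  moreover have "a = int ((m - 1) div k + 1)"
    unfolding assms(6) nk using m k by (rule Greatest_int_mult_less)
  moreover have "b = int ((m - 1) div (k + 1) + 1)"
    using Greatest_int_mult_less[of m "k + 1"] m unfolding assms(7) nk by (simp add: add.commute)
  moreover have "(real r - 1) * real m + real_of_int (int c) = real ((r - 1) * m + c)" for c
    using assms(8) by (simp add: of_nat_diff)
  ultimately show ?thesis unfolding H nk by (metis of_nat_le_iff)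
qed

end
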